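(* For $k\times k$ bimatrix games (with payoffs in $[0,1]$), the payoff query complexity of finding an $\epsilon$-Nash equilibrium for $\epsilon\in O\left(\frac1{\log k}\right)$ is $\Omega(k\log k)$. That is, for every constant $c>0$ there are constants $c'>0$ and $k_0$ such that for all $k\ge k_0$ and all $0\le\epsilon\le \frac{c}{\log k}$, the payoff query complexity of finding an $\epsilon$-Nash equilibrium of a $k\times k$ bimatrix game is at least $c'\,k\log k$.
   Context: A $k\times k$ bimatrix game is a pair $(R,C)$ of $k\times k$ matrices: $R$ gives the payoffs of the row player and $C$ those of the column player; all payoffs are assumed to lie in $[0,1]$. A mixed strategy is a probability distribution over $[k]=\{1,\dots,k\}$. Under a mixed strategy profile $(\mathbf x,\mathbf y)$ the row player's regret is $\max_{j\in[k]}(R_j\cdot\mathbf y)-\mathbf x\cdot R\cdot\mathbf y$ and the column player's regret is $\max_{j\in[k]}(\mathbf x\cdot C)_j-\mathbf x\cdot C\cdot\mathbf y$. The profile is an $\epsilon$-Nash equilibrium if both regrets are at most $\epsilon$. A payoff query selects a pure-strategy profile (row $r$, column $c$) and receives as response the payoffs $R_{r,c}$ and $C_{r,c}$. The payoff query complexity of a class of games with respect to a solution concept is the smallest $N$ such that some (deterministic) algorithm, initially knowing none of the payoffs, finds a solution of every game in the class using at most $N$ payoff queries. Queries may be chosen adaptively, and no computational bound is imposed on the algorithm. *)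

theory Defs
  imports "Jordan_Normal_Form.Matrix" "HOL-Library.Extended_Real"
begin

text \<open>Strategies are numbered from 0, so \<open>[k]\<close> is the index set \<open>{..<k}\<close>.
  A game is a pair \<open>(R, C)\<close> of payoff matrices, a strategy profile a pair \<open>(x, y)\<close> of vectors.\<close>

type_synonym bimatrix_game = "real mat \<times> real mat"
type_synonym profile = "real vec \<times> real vec"

definition bimatrix_games :: "nat \<Rightarrow> bimatrix_game set" where
  "bimatrix_games k = {(R, C). R \<in> carrier_mat k k \<and> C \<in> carrier_mat k k \<and>
     (\<forall>i<k. \<forall>j<k. R $$ (i, j) \<in> {0..1} \<and> C $$ (i, j) \<in> {0..1})}"

definition mixed_strategy :: "nat \<Rightarrow> real vec \<Rightarrow> bool" where
  "mixed_strategy k x \<longleftrightarrow> x \<in> carrier_vec k \<and> (\<forall>i<k. 0 \<le> x $ i) \<and> (\<Sum>i<k. x $ i) = 1"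

definition row_regret :: "nat \<Rightarrow> bimatrix_game \<Rightarrow> profile \<Rightarrow> real" where
  "row_regret k = (\<lambda>(R, C) (x, y). Max ((\<lambda>j. row R j \<bullet> y) ` {..<k}) - x \<bullet> (R *\<^sub>v y))"

definition col_regret :: "nat \<Rightarrow> bimatrix_game \<Rightarrow> profile \<Rightarrow> real" where
  "col_regret k = (\<lambda>(R, C) (x, y). Max ((\<lambda>j. x \<bullet> col C j) ` {..<k}) - x \<bullet> (C *\<^sub>v y))"

definition eps_nash :: "nat \<Rightarrow> real \<Rightarrow> bimatrix_game \<Rightarrow> profile \<Rightarrow> bool" where
  "eps_nash k \<epsilon> G p \<longleftrightarrow> mixed_strategy k (fst p) \<and> mixed_strategy k (snd p) \<and>
     row_regret k G p \<le> \<epsilon> \<and> col_regret k G p \<le> \<epsilon>"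

text \<open>A deterministic adaptive algorithm is a decision tree: \<open>Query r c f\<close> queries the pure
  profile \<open>(r, c)\<close> and continues with \<open>f a b\<close> if the responses are \<open>a\<close> (row player's payoff) and
  \<open>b\<close> (column player's payoff). The continuation is an arbitrary function, so no computational
  bound is imposed, and the tree may be infinitely branching. Every branch is finite, which is
  no restriction for algorithms with a bounded number of queries.\<close>

datatype 'o query_algorithm =
    Output 'o
  | Query nat nat "real \<Rightarrow> real \<Rightarrow> 'o query_algorithm"

primrec result :: "bimatrix_game \<Rightarrow> 'o query_algorithm \<Rightarrow> 'o" where
  "result G (Output p) = p"
| "result G (Query r c f) = result G (f (fst G $$ (r, c)) (snd G $$ (r, c)))"

primrec queries :: "bimatrix_game \<Rightarrow> 'o query_algorithm \<Rightarrow> (nat \<times> nat) list" where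
  "queries G (Output p) = []"
| "queries G (Query r c f) = (r, c) # queries G (f (fst G $$ (r, c)) (snd G $$ (r, c)))"

text \<open>Queries must select pure profiles of the game: entries of a matrix outside its dimensions
  are unspecified values, which an algorithm must not inspect.\<close>

definition solves_with_queries ::
  "nat \<Rightarrow> bimatrix_game set \<Rightarrow> (bimatrix_game \<Rightarrow> 'o \<Rightarrow> bool) \<Rightarrow> 'o query_algorithm \<Rightarrow> nat \<Rightarrow> bool" where
  "solves_with_queries k \<G> solution A N \<longleftrightarrow>
     (\<forall>G\<in>\<G>. set (queries G A) \<subseteq> {..<k} \<times> {..<k} \<and>
             length (queries G A) \<le> N \<and> solution G (result G A))"

text \<open>The smallest number of queries that suffices, for a class of \<open>k \<times> k\<close> games. The value is
  \<open>\<infinity>\<close> if no number of queries suffices, rather than an arbitrary natural number.\<close>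

definition payoff_query_complexity ::
  "nat \<Rightarrow> bimatrix_game set \<Rightarrow> (bimatrix_game \<Rightarrow> 'o \<Rightarrow> bool) \<Rightarrow> enat" where
  "payoff_query_complexity k \<G> solution =
     Inf {enat N | N. \<exists>A. solves_with_queries k \<G> solution A N}"

end

theory Submission
  imports Defs
begin

text \<open>Consider generalised matching pennies: \<open>R\<close> is the identity matrix and \<open>C = 1 - R\<close>. In every
  \<open>\<epsilon>\<close>-equilibrium \<open>(x, y)\<close> no column has probability above \<open>M = 1/k + 2 * \<epsilon>\<close>. Raise all entries of
  row \<open>i\<close> of \<open>R\<close> that the algorithm does not query to 1. The algorithm still answers \<open>(x, y)\<close>, but
  row \<open>i\<close> now pays at least \<open>1 - q\<^sub>i * M\<close> against \<open>y\<close>, where \<open>q\<^sub>i\<close> is the number of queried columns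
  in row \<open>i\<close>, while the row player's payoff is at most \<open>1/k + \<epsilon> + x\<^sub>i\<close>. Hence
  \<open>1 - q\<^sub>i * M \<le> M + x\<^sub>i\<close>, and summing over \<open>i\<close> gives \<open>(k - 1) / M - k\<close> queries. For
  \<open>\<epsilon> \<le> c / ln k\<close> this is of order \<open>k * ln k\<close>.\<close>

section \<open>Payoffs and regrets as finite sums\<close>

lemma row_scalar_prod:
  fixes A :: "real mat"
  assumes "A \<in> carrier_mat m n" "y \<in> carrier_vec n" "i < m"
  shows "row A i \<bullet> y = (\<Sum>j<n. A $$ (i, j) * y $ j)"
  using assms by (auto simp: scalar_prod_def lessThan_atLeast0 intro!: sum.cong)

lemma scalar_prod_col:
  fixes A :: "real mat"
  assumes "A \<in> carrier_mat m n" "x \<in> carrier_vec m" "j < n"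
  shows "x \<bullet> col A j = (\<Sum>i<m. x $ i * A $$ (i, j))"
  using assms by (auto simp: scalar_prod_def lessThan_atLeast0 intro!: sum.cong)

lemma scalar_prod_mult_mat_vec:
  fixes A :: "real mat"
  assumes "A \<in> carrier_mat m n" "y \<in> carrier_vec n"
  shows "x \<bullet> (A *\<^sub>v y) = (\<Sum>i<m. x $ i * (\<Sum>j<n. A $$ (i, j) * y $ j))"
proof -
  have "x \<bullet> (A *\<^sub>v y) = (\<Sum>i<m. x $ i * (row A i \<bullet> y))"
    using assms by (auto simp: scalar_prod_def lessThan_atLeast0 intro!: sum.cong)
  also have "\<dots> = (\<Sum>i<m. x $ i * (\<Sum>j<n. A $$ (i, j) * y $ j))"
    using assms by (intro sum.cong refl) (simp add: row_scalar_prod)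
  finally show ?thesis .
qed

text \<open>Turns the maximum in the regret into one inequality per pure deviation, with products as
  finite sums, so that payoffs of concrete games can be evaluated entry by entry.\<close>

lemma eps_nash_row_le:
  assumes "R \<in> carrier_mat k k" "eps_nash k \<epsilon> (R, C) (x, y)" "i < k"
  shows "(\<Sum>j<k. R $$ (i, j) * y $ j) \<le> (\<Sum>i<k. x $ i * (\<Sum>j<k. R $$ (i, j) * y $ j)) + \<epsilon>"
proof -
  have y: "y \<in> carrier_vec k" and "row_regret k (R, C) (x, y) \<le> \<epsilon>"
    using assms by (auto simp: eps_nash_def mixed_strategy_def)
  then have "Max ((\<lambda>j. row R j \<bullet> y) ` {..<k}) \<le> x \<bullet> (R *\<^sub>v y) + \<epsilon>"
    by (simp add: row_regret_def)
  moreover have "row R i \<bullet> y \<le> Max ((\<lambda>j. row R j \<bullet> y) ` {..<k})"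
    using assms by (intro Max_ge) auto
  ultimately have "row R i \<bullet> y \<le> x \<bullet> (R *\<^sub>v y) + \<epsilon>" by linarith
  then show ?thesis
    using assms y by (simp add: row_scalar_prod[of R k k] scalar_prod_mult_mat_vec[of R k k])
qed

lemma eps_nash_col_le:
  assumes "C \<in> carrier_mat k k" "eps_nash k \<epsilon> (R, C) (x, y)" "j < k"
  shows "(\<Sum>i<k. x $ i * C $$ (i, j)) \<le> (\<Sum>i<k. x $ i * (\<Sum>j<k. C $$ (i, j) * y $ j)) + \<epsilon>"
proof -
  have xy: "x \<in> carrier_vec k" "y \<in> carrier_vec k" and "col_regret k (R, C) (x, y) \<le> \<epsilon>"
    using assms by (auto simp: eps_nash_def mixed_strategy_def)
  then have "Max ((\<lambda>j. x \<bullet> col C j) ` {..<k}) \<le> x \<bullet> (C *\<^sub>v y) + \<epsilon>"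
    by (simp add: col_regret_def)
  moreover have "x \<bullet> col C j \<le> Max ((\<lambda>j. x \<bullet> col C j) ` {..<k})"
    using assms by (intro Max_ge) auto
  ultimately have "x \<bullet> col C j \<le> x \<bullet> (C *\<^sub>v y) + \<epsilon>" by linarith
  then show ?thesis
    using assms xy by (simp add: scalar_prod_col[of C k k] scalar_prod_mult_mat_vec[of C k k])
qed

section \<open>Decision trees and query complexity\<close>

text \<open>The answers determine the branch taken. Agreement on the entries queried in
  \<open>G\<close> is enough, since \<open>G'\<close> is then led down the same branch.\<close>

lemma result_eqI:
  assumes "\<And>r c. (r, c) \<in> set (queries G A) \<Longrightarrow>
    fst G' $$ (r, c) = fst G $$ (r, c) \<and> snd G' $$ (r, c) = snd G $$ (r, c)"
  shows "result G' A = result G A"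
  using assms by (induction A) auto

text \<open>A nonempty set of extended naturals contains its infimum, so some algorithm attains the
  complexity; the infimum of the empty set is infinite and exceeds any real bound.\<close>

lemma le_payoff_query_complexityI:
  assumes "\<And>N A. solves_with_queries k \<G> solution (A :: 'o query_algorithm) N \<Longrightarrow> b \<le> real N"
  shows "ereal b \<le> ereal_of_enat (payoff_query_complexity k \<G> (solution :: _ \<Rightarrow> 'o \<Rightarrow> bool))"
proof -
  define S where "S = {enat N | N. \<exists>A. solves_with_queries k \<G> solution A N}"
  have "ereal b \<le> ereal_of_enat (Inf S)"
  proof (cases "S = {}")
    case True
    then show ?thesis by (simp add: top_enat_def)
  next
    case False
    then have "Inf S \<in> S"
      unfolding Inf_enat_def by (auto intro: LeastI)
    then show ?thesis
      using assms by (auto simp: S_def)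
  qed
  then show ?thesis by (simp add: payoff_query_complexity_def S_def)
qed

section \<open>Generalised matching pennies and its perturbations\<close>

definition pennies_row :: "nat \<Rightarrow> real mat" where
  "pennies_row k = mat k k (\<lambda>(i, j). if i = j then 1 else 0)"

definition pennies_col :: "nat \<Rightarrow> real mat" where
  "pennies_col k = mat k k (\<lambda>(i, j). if i = j then 0 else 1)"

text \<open>\<open>Q\<close> stands for the profiles queried in matching pennies. The entries in
  \<open>Q\<close> are those of \<open>pennies_row k\<close>, so the queries cannot tell the two
  matrices apart.\<close>

definition raised_row :: "nat \<Rightarrow> (nat \<times> nat) set \<Rightarrow> nat \<Rightarrow> real mat" where
  "raised_row k Q i =
     mat k k (\<lambda>(r, j). if r = j \<or> (r = i \<and> (r, j) \<notin> Q) then 1 else 0)"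

lemma pennies_in_bimatrix_games: "(pennies_row k, pennies_col k) \<in> bimatrix_games k"
  by (auto simp: bimatrix_games_def pennies_row_def pennies_col_def)

lemma raised_in_bimatrix_games: "(raised_row k Q i, pennies_col k) \<in> bimatrix_games k"
  by (auto simp: bimatrix_games_def raised_row_def pennies_col_def)

lemma pennies_row_sum:
  assumes "i < k"
  shows "(\<Sum>j<k. pennies_row k $$ (i, j) * y $ j) = y $ i"
proof -
  have "(\<Sum>j<k. pennies_row k $$ (i, j) * y $ j) = (\<Sum>j<k. if j = i then y $ j else 0)"
    using assms by (intro sum.cong) (auto simp: pennies_row_def)
  then show ?thesis using assms by simp
qed

lemma pennies_col_entry:
  assumes "i < k" "j < k"
  shows "pennies_col k $$ (i, j) = 1 - pennies_row k $$ (i, j)"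
  using assms by (simp add: pennies_row_def pennies_col_def)

lemma pennies_col_sum:
  assumes "i < k" "(\<Sum>j<k. y $ j) = 1"
  shows "(\<Sum>j<k. pennies_col k $$ (i, j) * y $ j) = 1 - y $ i"
  using assms by (simp add: pennies_col_entry left_diff_distrib sum_subtractf pennies_row_sum)

lemma pennies_col_sum_left:
  assumes "j < k" "(\<Sum>i<k. x $ i) = 1"
  shows "(\<Sum>i<k. x $ i * pennies_col k $$ (i, j)) = 1 - x $ j"
proof -
  \<comment> \<open>The matrix is symmetric, which reduces column sums to row sums.\<close>
  have "(\<Sum>i<k. x $ i * pennies_col k $$ (i, j)) = (\<Sum>i<k. pennies_col k $$ (j, i) * x $ i)"
    using assms by (intro sum.cong) (auto simp: pennies_col_def)
  then show ?thesis using assms by (simp add: pennies_col_sum)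
qed

text \<open>Let \<open>v\<close> be the sum of all \<open>x $ i * y $ i\<close>. The column player
  gets \<open>1 - v\<close>, and \<open>1 - x $ j\<close> by deviating to column \<open>j\<close>.
  So \<open>v \<le> x $ j + \<epsilon>\<close> for every \<open>j\<close>, and averaging over
  \<open>j\<close> gives the first bound. Deviating to row \<open>i\<close> pays
  \<open>y $ i\<close>, so \<open>y $ i \<le> v + \<epsilon>\<close>.\<close>

lemma pennies_eps_nash_bounds:
  assumes nash: "eps_nash k \<epsilon> (pennies_row k, pennies_col k) (x, y)" and "0 < k"
  shows "(\<Sum>i<k. x $ i * y $ i) \<le> 1 / k + \<epsilon>"
    and "i < k \<Longrightarrow> y $ i \<le> 1 / k + 2 * \<epsilon>"
proof -
  let ?v = "\<Sum>i<k. x $ i * y $ i"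
  have sums: "(\<Sum>i<k. x $ i) = 1" "(\<Sum>i<k. y $ i) = 1"
    using nash by (auto simp: eps_nash_def mixed_strategy_def)
  have "?v \<le> x $ j + \<epsilon>" if "j < k" for j
  proof -
    have "1 - x $ j \<le> (\<Sum>i<k. x $ i * (1 - y $ i)) + \<epsilon>"
      using eps_nash_col_le[OF _ nash that] that sums
      by (simp add: pennies_col_sum pennies_col_sum_left) (simp add: pennies_col_def)
    then show ?thesis
      using sums by (simp add: right_diff_distrib sum_subtractf)
  qed
  then have "(\<Sum>j<k. ?v) \<le> (\<Sum>j<k. x $ j + \<epsilon>)"
    by (intro sum_mono) auto
  then show v: "?v \<le> 1 / k + \<epsilon>"
    using sums \<open>0 < k\<close> by (simp add: sum.distrib field_simps)
  show "y $ i \<le> 1 / k + 2 * \<epsilon>" if "i < k"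
  proof -
    have "y $ i \<le> ?v + \<epsilon>"
      using eps_nash_row_le[OF _ nash that] that
      by (simp add: pennies_row_sum) (simp add: pennies_row_def)
    then show ?thesis using v by simp
  qed
qed

section \<open>Counting queries row by row\<close>

lemma unqueried_row_bound:
  assumes nash: "eps_nash k \<epsilon> (pennies_row k, pennies_col k) (x, y)"
    and nash': "eps_nash k \<epsilon> (raised_row k Q i, pennies_col k) (x, y)"
    and i: "i < k" and Q: "finite Q"
  shows "1 - x $ i \<le> (real (card {j. (i, j) \<in> Q}) + 1) * (1 / k + 2 * \<epsilon>)"
proof -
  let ?M = "1 / k + 2 * \<epsilon>" and ?R = "raised_row k Q i"
  define q where "q = {j. (i, j) \<in> Q}"
  define s where "s = (\<Sum>j<k. ?R $$ (i, j) * y $ j)"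
  have x: "0 \<le> x $ j" and y: "0 \<le> y $ j" if "j < k" for j
    using nash that by (auto simp: eps_nash_def mixed_strategy_def)
  have sum_y: "(\<Sum>j<k. y $ j) = 1"
    using nash by (auto simp: eps_nash_def mixed_strategy_def)
  have M: "y $ j \<le> ?M" if "j < k" for j
    using pennies_eps_nash_bounds(2)[OF nash] that by simp
  have M0: "0 \<le> ?M"
    using M[OF i] y[OF i] by linarith
  have fin_q: "finite q"
    using finite_vimageI[OF Q, of "Pair i"] by (simp add: q_def vimage_def inj_on_def)
  have "1 - s = (\<Sum>j<k. (1 - ?R $$ (i, j)) * y $ j)"
    by (simp add: s_def sum_y left_diff_distrib sum_subtractf)
  \<comment> \<open>Row \<open>i\<close> differs from 1 only at columns in \<open>q\<close>, and
    each of these loses at most \<open>?M\<close>. A queried diagonal entry loses nothing.\<close>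
  also have "\<dots> \<le> (\<Sum>j<k. if j \<in> q then ?M else 0)"
    using i M M0 by (intro sum_mono) (auto simp: raised_row_def q_def)
  also have "\<dots> = (\<Sum>j\<in>{..<k} \<inter> q. ?M)"
    by (rule sum.inter_restrict[symmetric]) simp
  also have "\<dots> \<le> real (card q) * ?M"
    using fin_q M0 by (simp add: mult_right_mono card_mono)
  finally have lower: "1 - s \<le> real (card q) * ?M" .
  have s1: "s \<le> 1"
  proof -
    have "s \<le> (\<Sum>j<k. 1 * y $ j)"
      unfolding s_def using i y by (intro sum_mono mult_right_mono) (auto simp: raised_row_def)
    then show ?thesis using sum_y by simp
  qed
  have other_rows: "(\<Sum>j<k. ?R $$ (r, j) * y $ j) = y $ r" if "r < k" "r \<noteq> i" for r
  proof -
    have "(\<Sum>j<k. ?R $$ (r, j) * y $ j) = (\<Sum>j<k. pennies_row k $$ (r, j) * y $ j)"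
      using that by (intro sum.cong) (auto simp: raised_row_def pennies_row_def)
    then show ?thesis using that by (simp add: pennies_row_sum)
  qed
  have "s \<le> (\<Sum>r<k. x $ r * (\<Sum>j<k. ?R $$ (r, j) * y $ j)) + \<epsilon>"
    unfolding s_def by (rule eps_nash_row_le[OF _ nash' i]) (simp add: raised_row_def)
  also have "(\<Sum>r<k. x $ r * (\<Sum>j<k. ?R $$ (r, j) * y $ j))
      \<le> (\<Sum>r<k. x $ r * y $ r + (if r = i then x $ i else 0))"
  proof (rule sum_mono)
    fix r assume "r \<in> {..<k}"
    then have r: "r < k" by simp
    show "x $ r * (\<Sum>j<k. ?R $$ (r, j) * y $ j) \<le> x $ r * y $ r + (if r = i then x $ i else 0)"
    proof (cases "r = i")
      case True
      \<comment> \<open>The term of row \<open>i\<close> is at most \<open>x $ i\<close>; the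
        nonnegative \<open>x $ i * y $ i\<close> is added to complete the sum of products over all
        rows.\<close>
      have "x $ i * s \<le> x $ i" "0 \<le> x $ i * y $ i"
        using x[OF i] y[OF i] s1 by (auto intro: mult_left_le)
      then show ?thesis using True by (simp add: s_def)
    next
      case False
      then show ?thesis using r other_rows by simp
    qed
  qed
  also have "\<dots> = (\<Sum>r<k. x $ r * y $ r) + x $ i"
    using i by (simp add: sum.distrib)
  \<comment> \<open>This sum depends only on the profile, so the bound from matching pennies carries
    over. The regret in the raised game adds the second \<open>\<epsilon>\<close> of
    \<open>?M\<close>.\<close>
  also have "(\<Sum>r<k. x $ r * y $ r) \<le> 1 / k + \<epsilon>"
    using pennies_eps_nash_bounds(1)[OF nash] i by simp
  finally have "s \<le> ?M + x $ i" by simp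
  with lower have "1 - x $ i \<le> real (card q) * ?M + ?M" by linarith
  then show ?thesis unfolding q_def distrib_right by simp
qed

lemma queries_lower_bound:
  assumes solves: "solves_with_queries k (bimatrix_games k) (eps_nash k \<epsilon>) A N"
    and k: "0 < k"
  shows "real k - 1 \<le> (real N + real k) * (1 / k + 2 * \<epsilon>)"
proof -
  let ?M = "1 / k + 2 * \<epsilon>"
  define G where "G = (pennies_row k, pennies_col k)"
  define Q where "Q = set (queries G A)"
  obtain x y where xy: "result G A = (x, y)" by fastforce
  have nash: "eps_nash k \<epsilon> (pennies_row k, pennies_col k) (x, y)"
    and Q: "Q \<subseteq> {..<k} \<times> {..<k}" and len: "length (queries G A) \<le> N"
    using solves pennies_in_bimatrix_games[of k] xy[symmetric]
    by (auto simp: solves_with_queries_def G_def Q_def)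
  have sum_x: "(\<Sum>i<k. x $ i) = 1" and y0: "0 \<le> y $ 0"
    using nash k by (auto simp: eps_nash_def mixed_strategy_def)
  \<comment> \<open>The sign of \<open>\<epsilon>\<close> is not fixed here, so nonnegativity comes
    from \<open>y $ 0 \<le> ?M\<close>.\<close>
  have M0: "0 \<le> ?M"
    using pennies_eps_nash_bounds(2)[OF nash, of 0] y0 k by linarith
  have "1 - x $ i \<le> (real (card {j. (i, j) \<in> Q}) + 1) * ?M" if "i < k" for i
  proof (rule unqueried_row_bound[OF nash _ that])
    let ?G = "(raised_row k Q i, pennies_col k)"
    have "result ?G A = result G A"
    proof (rule result_eqI)
      fix r j assume "(r, j) \<in> set (queries G A)"
      then have "(r, j) \<in> Q" "r < k" "j < k" using Q by (auto simp: Q_def)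
      then show "fst ?G $$ (r, j) = fst G $$ (r, j) \<and> snd ?G $$ (r, j) = snd G $$ (r, j)"
        by (auto simp: G_def raised_row_def pennies_row_def)
    qed
    then show "eps_nash k \<epsilon> ?G (x, y)"
      using solves raised_in_bimatrix_games[of k Q i] xy
      by (auto simp: solves_with_queries_def)
  qed (simp add: Q_def)
  then have "(\<Sum>i<k. 1 - x $ i) \<le> (\<Sum>i<k. (real (card {j. (i, j) \<in> Q}) + 1) * ?M)"
    by (intro sum_mono) auto
  also have "\<dots> = (real (\<Sum>i<k. card {j. (i, j) \<in> Q}) + real k) * ?M"
    unfolding sum_distrib_right[symmetric] by (simp add: sum.distrib)
  also have "(\<Sum>i<k. card {j. (i, j) \<in> Q}) = card Q"
  proof -
    have "finite {j. (i, j) \<in> Q}" for i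
      using Q by (auto intro: finite_subset[of _ "{..<k}"])
    then have "(\<Sum>i<k. card {j. (i, j) \<in> Q}) = card (Sigma {..<k} (\<lambda>i. {j. (i, j) \<in> Q}))"
      by (simp add: card_SigmaI)
    also have "Sigma {..<k} (\<lambda>i. {j. (i, j) \<in> Q}) = Q" using Q by auto
    finally show ?thesis .
  qed
  \<comment> \<open>Repeated queries count once in \<open>Q\<close>, hence an inequality.\<close>
  also have "(real (card Q) + real k) * ?M \<le> (real N + real k) * ?M"
    using card_length[of "queries G A"] len M0
    by (intro mult_right_mono) (auto simp: Q_def)
  finally show ?thesis by (simp add: sum_subtractf sum_x)
qed

section \<open>Asymptotics\<close>

theorem theorem13:
  fixes c :: real
  assumes "c > 0"
  shows "\<exists>c'::real. c' > 0 \<and> (\<exists>k0::nat. \<forall>k\<ge>k0. \<forall>\<epsilon>::real.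
           0 \<le> \<epsilon> \<and> \<epsilon> \<le> c / ln (real k) \<longrightarrow>
             ereal (c' * real k * ln (real k))
               \<le> ereal_of_enat (payoff_query_complexity k (bimatrix_games k) (eps_nash k \<epsilon>)))"
proof -
  \<comment> \<open>Chosen so that \<open>1 / k + 2 * \<epsilon> \<le> D / ln k\<close>.\<close>
  define D where "D = 1 + 2 * c"
  \<comment> \<open>Gives \<open>k - 1 \<ge> k / 2\<close> and \<open>ln k \<ge> 4 * D\<close>; the
    latter absorbs the term \<open>D * k\<close> below.\<close>
  define k0 where "k0 = max 2 (nat \<lceil>exp (4 * D)\<rceil>)"
  have D: "D > 0" using assms by (simp add: D_def)
  have "1 / (4 * D) * real k * ln (real k) \<le> real N"
    if k: "k \<ge> k0" and \<epsilon>: "0 \<le> \<epsilon>" "\<epsilon> \<le> c / ln (real k)"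
      and solves: "solves_with_queries k (bimatrix_games k) (eps_nash k \<epsilon>) A N"
    for k N \<epsilon> and A :: "profile query_algorithm"
  proof -
    let ?L = "ln (real k)"
    have k2: "real k \<ge> 2" using k by (simp add: k0_def)
    have "exp (4 * D) \<le> real k"
      using k by (simp add: k0_def)
    then have L: "4 * D \<le> ?L"
      using k2 by (subst ln_ge_iff) auto
    with D have L0: "?L > 0" by linarith
    have "?L \<le> real k" using k2 ln_less_self[of "real k"] by linarith
    then have "1 / k + 2 * \<epsilon> \<le> 1 / ?L + 2 * (c / ?L)"
      using \<epsilon> L0 k2 by (intro add_mono) (auto intro: divide_left_mono)
    also have "\<dots> = D / ?L" by (simp add: D_def add_divide_distrib)
    finally have "(real N + real k) * (1 / k + 2 * \<epsilon>) \<le> (real N + real k) * (D / ?L)"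
      by (rule mult_left_mono) simp
    with queries_lower_bound[OF solves] k2 have "real k - 1 \<le> (real N + real k) * (D / ?L)"
      by linarith
    then have "(real k - 1) * ?L \<le> D * real N + D * real k"
      using L0 by (simp add: field_simps)
    \<comment> \<open>Half of \<open>k * ?L\<close> is at most \<open>D * N + D * k\<close>, and
      \<open>D * k\<close> takes at most a quarter of \<open>k * ?L\<close>. The remaining quarter
      is at most \<open>D * N\<close>, whence the constant \<open>1 / (4 * D)\<close>.\<close>
    moreover have "real k / 2 * ?L \<le> (real k - 1) * ?L"
      using k2 L0 by (intro mult_right_mono) auto
    moreover have "4 * D * real k \<le> ?L * real k"
      using L by (intro mult_right_mono) auto
    ultimately have "real k * ?L \<le> 4 * (D * real N)"
      by (simp add: algebra_simps)
    then show ?thesis using D by (simp add: field_simps)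
  qed
  then have "\<forall>k\<ge>k0. \<forall>\<epsilon>. 0 \<le> \<epsilon> \<and> \<epsilon> \<le> c / ln (real k) \<longrightarrow>
      ereal (1 / (4 * D) * real k * ln (real k))
        \<le> ereal_of_enat (payoff_query_complexity k (bimatrix_games k) (eps_nash k \<epsilon>))"
    by (blast intro: le_payoff_query_complexityI)
  then show ?thesis
    using D by (intro exI[of _ "1 / (4 * D)"]) auto
qed

end
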